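(* Let $0\to V\xrightarrow{i}\widehat A\xrightarrow{p}A\to 0$ be an abelian extension of an associative 2-algebra $A$ by $V$, let $\sigma=(\sigma_0,\sigma_1)$ be a splitting of $p$, and (viewing $V$ as a subcomplex of $\widehat A$) define for $x,y\in A_0$, $a\in A_1$, $u\in V_0$, $m\in V_1$: $$x\triangleright (u+m)=\sigma_0(x)\cdot (u+m),\quad (u+m)\triangleleft x=(u+m)\cdot\sigma_0(x),$$ $$a\triangleright u=\sigma_1(a)\cdot u,\quad u\triangleleft a=u\cdot\sigma_1(a),$$ $$[x,y,u]=\widehat l_3(\sigma_0(x),\sigma_0(y),u),\quad [x,u,y]=\widehat l_3(\sigma_0(x),u,\sigma_0(y)),\quad [u,x,y]=\widehat l_3(u,\sigma_0(x),\sigma_0(y)),$$ where the products on the right-hand sides are those of $\widehat A$. Then: (1) with these maps, $V$ is a representation of the associative 2-algebra $A$; (2) this representation does not depend on the choice of the splitting $\sigma$; (3) equivalent abelian extensions give the same representation of $A$ on $V$.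
   Context: All vector spaces are over a fixed field. An associative 2-algebra $A=A_1\oplus A_0$, written $(A;d,\cdot,l_3)$, consists of a linear map $d:A_1\to A_0$, bilinear products $A_i\otimes A_j\to A_{i+j}$ for $0\le i+j\le 1$ (all written $\cdot$), and a trilinear map $l_3:A_0\otimes A_0\otimes A_0\to A_1$ such that for all $x,y,z,t\in A_0$, $a,b\in A_1$: (a) $d(x\cdot a)=x\cdot da$; (b) $d(a\cdot x)=da\cdot x$; (c) $da\cdot b=a\cdot db$; (d) $d\,l_3(x,y,z)=(x\cdot y)\cdot z-x\cdot(y\cdot z)$; (e1) $l_3(x,y,da)=(x\cdot y)\cdot a-x\cdot(y\cdot a)$; (e2) $l_3(x,da,y)=(x\cdot a)\cdot y-x\cdot(a\cdot y)$; (e3) $l_3(da,x,y)=(a\cdot x)\cdot y-a\cdot(x\cdot y)$; (f) $x\cdot l_3(y,z,t)+l_3(x,y,z)\cdot t=l_3(x\cdot y,z,t)-l_3(x,y\cdot z,t)+l_3(x,y,z\cdot t)$. A homomorphism $F:(A;d,\cdot,l_3)\to(A';d',\cdot',l_3')$ consists of linear maps $F_0:A_0\to A_0'$, $F_1:A_1\to A_1'$ and a bilinear map $F_2:A_0\times A_0\to A_1'$ with $F_0d=d'F_1$; $F_0(x\cdot y)-F_0(x)\cdot'F_0(y)=d'F_2(x,y)$; $F_1(x\cdot a)-F_0(x)\cdot'F_1(a)=F_2(x,da)$; $F_1(a\cdot x)-F_1(a)\cdot'F_0(x)=F_2(da,x)$; $F_1(l_3(x,y,z))-l_3'(F_0x,F_0y,F_0z)=F_2(x,y\cdot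 z)-F_2(x\cdot y,z)+F_0(x)\cdot'F_2(y,z)-F_2(x,y)\cdot'F_0(z)$. It is strict if $F_2=0$. Composition is $(GF)_0=G_0F_0$, $(GF)_1=G_1F_1$, $(GF)_2=G_2\circ(F_0\times F_0)+G_1\circ F_2$. A representation of $A$ on a 2-term complex $d_V:V_1\to V_0$ consists of an action of $A_0$ on $V$ (bilinear maps $\triangleright:A_0\otimes V_i\to V_i$, $\triangleleft:V_i\otimes A_0\to V_i$, $i=0,1$), bilinear maps $\triangleright:A_1\otimes V_0\to V_1$, $\triangleleft:V_0\otimes A_1\to V_1$, and three trilinear maps with values in $V_1$, written $(x,y,u)\mapsto[x,y,u]$, $(x,u,y)\mapsto[x,u,y]$, $(u,x,y)\mapsto[u,x,y]$ ($x,y\in A_0$, $u\in V_0$), such that for all $x,y,z\in A_0$, $a\in A_1$, $u\in V_0$, $m\in V_1$: - $(x\cdot y)\triangleright u-x\triangleright(y\triangleright u)=d_V[x,y,u]$, $(x\cdot y)\triangleright m-x\triangleright(y\triangleright m)=[x,y,d_Vm]$, $(x\cdot a)\triangleright u-x\triangleright(a\triangleright u)=[x,da,u]$, $(a\cdot x)\triangleright u-a\triangleright(x\triangleright u)=[da,x,u]$; - $(x\triangleright u)\triangleleft y-x\triangleright(u\triangleleft y)=d_V[x,u,y]$, $(x\triangleright m)\triangleleft y-x\triangleright(m\triangleleft y)=[x,d_Vm,y]$, $(x\triangleright u)\triangleleft a-x\triangleright(u\triangleleft a)=[x,u,da]$, $(a\triangleright u)\triangleleft y-a\triangleright(u\triangleleft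 y)=[da,u,y]$; - $u\triangleleft(x\cdot y)-(u\triangleleft x)\triangleleft y=d_V[u,x,y]$, $m\triangleleft(x\cdot y)-(m\triangleleft x)\triangleleft y=[d_Vm,x,y]$, $u\triangleleft(x\cdot a)-(u\triangleleft x)\triangleleft a=[u,x,da]$, $u\triangleleft(a\cdot x)-(u\triangleleft a)\triangleleft x=[u,da,x]$; - $x\triangleright[u,y,z]+[x,u,y]\triangleleft z=[x\triangleright u,y,z]-[x,u\triangleleft y,z]+[x,u,y\cdot z]$; - $x\triangleright[y,u,z]+[x,y,u]\triangleleft z=[x\cdot y,u,z]-[x,y\triangleright u,z]+[x,y,u\triangleleft z]$; - $x\triangleright[y,z,u]+l_3(x,y,z)\triangleright u=[x\cdot y,z,u]-[x,y\cdot z,u]+[x,y,z\triangleright u]$; - $u\triangleleft l_3(x,y,z)+[u,x,y]\triangleleft z=[u\triangleleft x,y,z]-[u,x\cdot y,z]+[u,x,y\cdot z]$. Extensions. An extension of $A$ by $V$ is a short exact sequence $0\to V\xrightarrow{i}\widehat A\xrightarrow{p}A\to0$ of associative 2-algebras and strict homomorphisms ($\mathrm{Im}(i)=\mathrm{Ker}(p)$, $\mathrm{Ker}(i)=0$, $\mathrm{Im}(p)=A$); $\widehat A$ has structure $(\widehat d,\cdot,\widehat l_3)$, and $V=(V_1\xrightarrow{d_V}V_0)$ is regarded as a subcomplex of $\widehat A$ via $i$. It is an abelian extension if $V$ is abelian, i.e. the product of $V$ is zero and $l_3$ of $V$ is zero. A splitting $\sigma$ of $p$ is a pair of linear maps $\sigma_0:A_0\to\widehat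 A_0$, $\sigma_1:A_1\to\widehat A_1$ with $p_0\sigma_0=\mathrm{id}$, $p_1\sigma_1=\mathrm{id}$. Two extensions $0\to V\xrightarrow{i}\widehat A\xrightarrow{p}A\to0$ and $0\to V\xrightarrow{j}\widetilde A\xrightarrow{q}A\to0$ are equivalent if there is a homomorphism $F:\widehat A\to\widetilde A$ of associative 2-algebras with $F\circ i=j$, $q\circ F=p$, and $F_2(i(u),\alpha)=0$ for all $u\in V_0$, $\alpha\in\widehat A_0$.
   Formalization: Corrected: in the third bullet of "representation" the left-hand sides have the opposite sign; "abelian" also requires l̂3 to vanish whenever two of its arguments lie in V; equivalence requires F_2(i(u),α)=0 and also F_2(α,i(u))=0. As printed, (1)–(3) fail. *)

theory Defs
  imports Complex_Main
begin

text \<open>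
  A vector space over the field \<open>'k\<close> is a type of class \<^class>\<open>ab_group_add\<close> with a scalar
  multiplication satisfying \<^locale>\<open>vector_space\<close>.  The subscripts of the field and
  component names below are degrees: \<open>mul01\<close> is the product \<open>A\<^sub>0 \<times> A\<^sub>1 \<rightarrow> A\<^sub>1\<close>, and so on.
\<close>

definition bilinear_map ::
  "('k::field \<Rightarrow> 'a::ab_group_add \<Rightarrow> 'a) \<Rightarrow> ('k \<Rightarrow> 'b::ab_group_add \<Rightarrow> 'b) \<Rightarrow>
   ('k \<Rightarrow> 'c::ab_group_add \<Rightarrow> 'c) \<Rightarrow> ('a \<Rightarrow> 'b \<Rightarrow> 'c) \<Rightarrow> bool"
  where "bilinear_map s1 s2 s3 f \<longleftrightarrow>
    (\<forall>x. Vector_Spaces.linear s2 s3 (f x)) \<and>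
    (\<forall>y. Vector_Spaces.linear s1 s3 (\<lambda>x. f x y))"

definition trilinear_map ::
  "('k::field \<Rightarrow> 'a::ab_group_add \<Rightarrow> 'a) \<Rightarrow> ('k \<Rightarrow> 'b::ab_group_add \<Rightarrow> 'b) \<Rightarrow>
   ('k \<Rightarrow> 'c::ab_group_add \<Rightarrow> 'c) \<Rightarrow> ('k \<Rightarrow> 'd::ab_group_add \<Rightarrow> 'd) \<Rightarrow>
   ('a \<Rightarrow> 'b \<Rightarrow> 'c \<Rightarrow> 'd) \<Rightarrow> bool"
  where "trilinear_map s1 s2 s3 s4 f \<longleftrightarrow>
    (\<forall>x y. Vector_Spaces.linear s3 s4 (f x y)) \<and>
    (\<forall>x z. Vector_Spaces.linear s2 s4 (\<lambda>y. f x y z)) \<and>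
    (\<forall>y z. Vector_Spaces.linear s1 s4 (\<lambda>x. f x y z))"


record ('k, 'a0, 'a1) two_term =
  scale0 :: "'k \<Rightarrow> 'a0 \<Rightarrow> 'a0"
  scale1 :: "'k \<Rightarrow> 'a1 \<Rightarrow> 'a1"
  diff :: "'a1 \<Rightarrow> 'a0"

record ('k, 'a0, 'a1) assoc2 = "('k, 'a0, 'a1) two_term" +
  mul00 :: "'a0 \<Rightarrow> 'a0 \<Rightarrow> 'a0"
  mul01 :: "'a0 \<Rightarrow> 'a1 \<Rightarrow> 'a1"
  mul10 :: "'a1 \<Rightarrow> 'a0 \<Rightarrow> 'a1"
  l3 :: "'a0 \<Rightarrow> 'a0 \<Rightarrow> 'a0 \<Rightarrow> 'a1"

definition two_term_complex ::
  "('k::field, 'a0::ab_group_add, 'a1::ab_group_add, 'z) two_term_scheme \<Rightarrow> bool"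
  where "two_term_complex V \<longleftrightarrow> Vector_Spaces.linear (scale1 V) (scale0 V) (diff V)"

locale assoc_2_algebra =
  fixes A :: "('k::field, 'a0::ab_group_add, 'a1::ab_group_add) assoc2"
  assumes complex: "two_term_complex A"
    and bilinear_mul00: "bilinear_map (scale0 A) (scale0 A) (scale0 A) (mul00 A)"
    and bilinear_mul01: "bilinear_map (scale0 A) (scale1 A) (scale1 A) (mul01 A)"
    and bilinear_mul10: "bilinear_map (scale1 A) (scale0 A) (scale1 A) (mul10 A)"
    and trilinear_l3: "trilinear_map (scale0 A) (scale0 A) (scale0 A) (scale1 A) (l3 A)"
    and diff_mul01: "diff A (mul01 A x a) = mul00 A x (diff A a)"
    and diff_mul10: "diff A (mul10 A a x) = mul00 A (diff A a) x"
    and peiffer: "mul01 A (diff A a) b = mul10 A a (diff A b)"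
    and diff_l3: "diff A (l3 A x y z) = mul00 A (mul00 A x y) z - mul00 A x (mul00 A y z)"
    and l3_diff3: "l3 A x y (diff A a) = mul01 A (mul00 A x y) a - mul01 A x (mul01 A y a)"
    and l3_diff2: "l3 A x (diff A a) y = mul10 A (mul01 A x a) y - mul01 A x (mul10 A a y)"
    and l3_diff1: "l3 A (diff A a) x y = mul10 A (mul10 A a x) y - mul10 A a (mul00 A x y)"
    and l3_cocycle:
      "mul01 A x (l3 A y z t) + mul10 A (l3 A x y z) t =
       l3 A (mul00 A x y) z t - l3 A x (mul00 A y z) t + l3 A x y (mul00 A z t)"


record ('a0, 'a1, 'b0, 'b1) hom2 =
  comp0 :: "'a0 \<Rightarrow> 'b0"
  comp1 :: "'a1 \<Rightarrow> 'b1"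
  comp2 :: "'a0 \<Rightarrow> 'a0 \<Rightarrow> 'b1"

locale assoc_2_hom =
  source: assoc_2_algebra A + target: assoc_2_algebra B
  for A :: "('k::field, 'a0::ab_group_add, 'a1::ab_group_add) assoc2"
    and B :: "('k, 'b0::ab_group_add, 'b1::ab_group_add) assoc2"
    and F :: "('a0, 'a1, 'b0, 'b1) hom2" +
  assumes linear0: "Vector_Spaces.linear (scale0 A) (scale0 B) (comp0 F)"
    and linear1: "Vector_Spaces.linear (scale1 A) (scale1 B) (comp1 F)"
    and bilinear2: "bilinear_map (scale0 A) (scale0 A) (scale1 B) (comp2 F)"
    and comp_diff: "comp0 F (diff A a) = diff B (comp1 F a)"
    and comp_mul00:
      "comp0 F (mul00 A x y) - mul00 B (comp0 F x) (comp0 F y) = diff B (comp2 F x y)"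
    and comp_mul01:
      "comp1 F (mul01 A x a) - mul01 B (comp0 F x) (comp1 F a) = comp2 F x (diff A a)"
    and comp_mul10:
      "comp1 F (mul10 A a x) - mul10 B (comp1 F a) (comp0 F x) = comp2 F (diff A a) x"
    and comp_l3:
      "comp1 F (l3 A x y z) - l3 B (comp0 F x) (comp0 F y) (comp0 F z) =
       comp2 F x (mul00 A y z) - comp2 F (mul00 A x y) z
       + mul01 B (comp0 F x) (comp2 F y z) - mul10 B (comp2 F x y) (comp0 F z)"

text \<open>
  In \<open>comp_l3\<close> the sign of the right-hand side follows the source.  It is opposite to
  the one suggested by applying \<open>diff B\<close> and using \<open>diff_l3\<close> and \<open>comp_mul00\<close>; strict
  homomorphisms, and the equivalences of extensions below, make sense with either sign.
\<close>

definition strict_hom ::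
  "('k::field, 'a0::ab_group_add, 'a1::ab_group_add) assoc2 \<Rightarrow>
   ('k, 'b0::ab_group_add, 'b1::ab_group_add) assoc2 \<Rightarrow> ('a0, 'a1, 'b0, 'b1) hom2 \<Rightarrow> bool"
  where "strict_hom A B F \<longleftrightarrow> assoc_2_hom A B F \<and> (\<forall>x y. comp2 F x y = 0)"

definition hom2_comp ::
  "('b0, 'b1, 'c0, 'c1::ab_group_add) hom2 \<Rightarrow> ('a0, 'a1, 'b0, 'b1) hom2 \<Rightarrow>
   ('a0, 'a1, 'c0, 'c1) hom2"
  where "hom2_comp G F =
    \<lparr> comp0 = comp0 G \<circ> comp0 F,
      comp1 = comp1 G \<circ> comp1 F,
      comp2 = (\<lambda>x y. comp2 G (comp0 F x) (comp0 F y) + comp1 G (comp2 F x y)) \<rparr>"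


text \<open>
  The fields of \<open>rep2\<close> are the maps \<open>x \<triangleright> u\<close>, \<open>x \<triangleright> m\<close>, \<open>u \<triangleleft> x\<close>, \<open>m \<triangleleft> x\<close>, \<open>a \<triangleright> u\<close>, \<open>u \<triangleleft> a\<close>,
  \<open>[x, y, u]\<close>, \<open>[x, u, y]\<close>, \<open>[u, x, y]\<close> for \<open>x, y \<in> A\<^sub>0\<close>, \<open>a \<in> A\<^sub>1\<close>, \<open>u \<in> V\<^sub>0\<close>, \<open>m \<in> V\<^sub>1\<close>,
  in this order.
\<close>

record ('a0, 'a1, 'v0, 'v1) rep2 =
  lact00 :: "'a0 \<Rightarrow> 'v0 \<Rightarrow> 'v0"
  lact01 :: "'a0 \<Rightarrow> 'v1 \<Rightarrow> 'v1"
  ract00 :: "'v0 \<Rightarrow> 'a0 \<Rightarrow> 'v0"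
  ract10 :: "'v1 \<Rightarrow> 'a0 \<Rightarrow> 'v1"
  lact10 :: "'a1 \<Rightarrow> 'v0 \<Rightarrow> 'v1"
  ract01 :: "'v0 \<Rightarrow> 'a1 \<Rightarrow> 'v1"
  brL :: "'a0 \<Rightarrow> 'a0 \<Rightarrow> 'v0 \<Rightarrow> 'v1"
  brM :: "'a0 \<Rightarrow> 'v0 \<Rightarrow> 'a0 \<Rightarrow> 'v1"
  brR :: "'v0 \<Rightarrow> 'a0 \<Rightarrow> 'a0 \<Rightarrow> 'v1"

text \<open>
  Sign of \<open>brR\<close>: the source prints the identities \<open>R1\<close> to \<open>R4\<close> with the opposite
  left-hand sides, \<open>u \<triangleleft> (x \<cdot> y) - (u \<triangleleft> x) \<triangleleft> y = d [u, x, y]\<close> etc.  That is a misprint: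
  \<open>C1\<close> to \<open>C4\<close> are instances of \<open>l3_cocycle\<close> and give \<open>[u, x, y]\<close> the sign of \<open>l\<^sub>3\<close>, and
  with that sign \<open>diff_l3\<close>, \<open>l3_diff1\<close>, \<open>l3_diff2\<close>, \<open>l3_diff3\<close> give \<open>R1\<close> to \<open>R4\<close>
  as stated here (with the printed sign the adjoint action of \<open>A\<close> on itself would not be a
  representation).
\<close>

locale assoc_2_rep =
  assoc_2_algebra A
  for A :: "('k::field, 'a0::ab_group_add, 'a1::ab_group_add) assoc2" +
  fixes V :: "('k, 'v0::ab_group_add, 'v1::ab_group_add, 'z) two_term_scheme"
    and R :: "('a0, 'a1, 'v0, 'v1) rep2"
  assumes V_complex: "two_term_complex V"
    and bilinear_lact00: "bilinear_map (scale0 A) (scale0 V) (scale0 V) (lact00 R)"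
    and bilinear_lact01: "bilinear_map (scale0 A) (scale1 V) (scale1 V) (lact01 R)"
    and bilinear_ract00: "bilinear_map (scale0 V) (scale0 A) (scale0 V) (ract00 R)"
    and bilinear_ract10: "bilinear_map (scale1 V) (scale0 A) (scale1 V) (ract10 R)"
    and bilinear_lact10: "bilinear_map (scale1 A) (scale0 V) (scale1 V) (lact10 R)"
    and bilinear_ract01: "bilinear_map (scale0 V) (scale1 A) (scale1 V) (ract01 R)"
    and trilinear_brL: "trilinear_map (scale0 A) (scale0 A) (scale0 V) (scale1 V) (brL R)"
    and trilinear_brM: "trilinear_map (scale0 A) (scale0 V) (scale0 A) (scale1 V) (brM R)"
    and trilinear_brR: "trilinear_map (scale0 V) (scale0 A) (scale0 A) (scale1 V) (brR R)"
    and L1: "lact00 R (mul00 A x y) u - lact00 R x (lact00 R y u) = diff V (brL R x y u)"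
    and L2: "lact01 R (mul00 A x y) m - lact01 R x (lact01 R y m) = brL R x y (diff V m)"
    and L3: "lact10 R (mul01 A x a) u - lact01 R x (lact10 R a u) = brL R x (diff A a) u"
    and L4: "lact10 R (mul10 A a x) u - lact10 R a (lact00 R x u) = brL R (diff A a) x u"
    and M1: "ract00 R (lact00 R x u) y - lact00 R x (ract00 R u y) = diff V (brM R x u y)"
    and M2: "ract10 R (lact01 R x m) y - lact01 R x (ract10 R m y) = brM R x (diff V m) y"
    and M3: "ract01 R (lact00 R x u) a - lact01 R x (ract01 R u a) = brM R x u (diff A a)"
    and M4: "ract10 R (lact10 R a u) y - lact10 R a (ract00 R u y) = brM R (diff A a) u y"
    and R1: "ract00 R (ract00 R u x) y - ract00 R u (mul00 A x y) = diff V (brR R u x y)"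
    and R2: "ract10 R (ract10 R m x) y - ract10 R m (mul00 A x y) = brR R (diff V m) x y"
    and R3: "ract01 R (ract00 R u x) a - ract01 R u (mul01 A x a) = brR R u x (diff A a)"
    and R4: "ract10 R (ract01 R u a) x - ract01 R u (mul10 A a x) = brR R u (diff A a) x"
    and C1: "lact01 R x (brR R u y z) + ract10 R (brM R x u y) z =
             brR R (lact00 R x u) y z - brM R x (ract00 R u y) z + brM R x u (mul00 A y z)"
    and C2: "lact01 R x (brM R y u z) + ract10 R (brL R x y u) z =
             brM R (mul00 A x y) u z - brM R x (lact00 R y u) z + brL R x y (ract00 R u z)"
    and C3: "lact01 R x (brL R y z u) + lact10 R (l3 A x y z) u =
             brL R (mul00 A x y) z u - brL R x (mul00 A y z) u + brL R x y (lact00 R z u)"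
    and C4: "ract01 R u (l3 A x y z) + ract10 R (brR R u x y) z =
             brR R (ract00 R u x) y z - brR R u (mul00 A x y) z + brR R u x (mul00 A y z)"


definition extension ::
  "('k::field, 'v0::ab_group_add, 'v1::ab_group_add) assoc2 \<Rightarrow>
   ('k, 'e0::ab_group_add, 'e1::ab_group_add) assoc2 \<Rightarrow>
   ('k, 'a0::ab_group_add, 'a1::ab_group_add) assoc2 \<Rightarrow>
   ('v0, 'v1, 'e0, 'e1) hom2 \<Rightarrow> ('e0, 'e1, 'a0, 'a1) hom2 \<Rightarrow> bool"
  where "extension V E A i p \<longleftrightarrow>
    strict_hom V E i \<and> strict_hom E A p \<and>
    range (comp0 i) = {e. comp0 p e = 0} \<and> range (comp1 i) = {e. comp1 p e = 0} \<and>
    {v. comp0 i v = 0} = {0} \<and> {v. comp1 i v = 0} = {0} \<and>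
    range (comp0 p) = UNIV \<and> range (comp1 p) = UNIV"

text \<open>
  \<open>V\<close> is abelian as an ideal of the middle term \<open>E\<close>: products of two elements of \<open>V\<close> vanish,
  and \<open>l\<^sub>3\<close> of \<open>E\<close> vanishes as soon as two of its arguments lie in \<open>V\<close>.  The source only
  says that the product and \<open>l\<^sub>3\<close> of \<open>V\<close> are zero; if \<open>l\<^sub>3\<close> vanishes merely
  on \<open>V \<times> V \<times> V\<close>, then \<open>[x, y, u]\<close> etc. below depend on the splitting.
\<close>

definition abelian_extension ::
  "('k::field, 'v0::ab_group_add, 'v1::ab_group_add) assoc2 \<Rightarrow>
   ('k, 'e0::ab_group_add, 'e1::ab_group_add) assoc2 \<Rightarrow>
   ('k, 'a0::ab_group_add, 'a1::ab_group_add) assoc2 \<Rightarrow>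
   ('v0, 'v1, 'e0, 'e1) hom2 \<Rightarrow> ('e0, 'e1, 'a0, 'a1) hom2 \<Rightarrow> bool"
  where "abelian_extension V E A i p \<longleftrightarrow>
    extension V E A i p \<and>
    (\<forall>u v. mul00 V u v = 0) \<and> (\<forall>u m. mul01 V u m = 0) \<and> (\<forall>m u. mul10 V m u = 0) \<and>
    (\<forall>u v w. l3 V u v w = 0) \<and>
    (\<forall>u v \<alpha>. l3 E (comp0 i u) (comp0 i v) \<alpha> = 0 \<and>
             l3 E (comp0 i u) \<alpha> (comp0 i v) = 0 \<and>
             l3 E \<alpha> (comp0 i u) (comp0 i v) = 0)"

definition splitting ::
  "('k::field, 'e0::ab_group_add, 'e1::ab_group_add) assoc2 \<Rightarrow>
   ('k, 'a0::ab_group_add, 'a1::ab_group_add) assoc2 \<Rightarrow>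
   ('e0, 'e1, 'a0, 'a1) hom2 \<Rightarrow> ('a0 \<Rightarrow> 'e0) \<Rightarrow> ('a1 \<Rightarrow> 'e1) \<Rightarrow> bool"
  where "splitting E A p \<sigma>0 \<sigma>1 \<longleftrightarrow>
    Vector_Spaces.linear (scale0 A) (scale0 E) \<sigma>0 \<and>
    Vector_Spaces.linear (scale1 A) (scale1 E) \<sigma>1 \<and>
    comp0 p \<circ> \<sigma>0 = id \<and> comp1 p \<circ> \<sigma>1 = id"

text \<open>
  \<open>i\<close> is not assumed to be an inclusion, so the elements of \<open>E\<close> on the right-hand sides, which
  lie in the image of \<open>i\<close> (the kernel of \<open>p\<close>), are transported back to \<open>V\<close> along the
  injections \<open>comp0 i\<close> and \<open>comp1 i\<close>.
\<close>

definition induced_rep ::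
  "('k, 'e0, 'e1) assoc2 \<Rightarrow> ('v0, 'v1, 'e0, 'e1) hom2 \<Rightarrow> ('a0 \<Rightarrow> 'e0) \<Rightarrow> ('a1 \<Rightarrow> 'e1) \<Rightarrow>
   ('a0, 'a1, 'v0, 'v1) rep2"
  where "induced_rep E i \<sigma>0 \<sigma>1 =
    \<lparr> lact00 = (\<lambda>x u. inv (comp0 i) (mul00 E (\<sigma>0 x) (comp0 i u))),
      lact01 = (\<lambda>x m. inv (comp1 i) (mul01 E (\<sigma>0 x) (comp1 i m))),
      ract00 = (\<lambda>u x. inv (comp0 i) (mul00 E (comp0 i u) (\<sigma>0 x))),
      ract10 = (\<lambda>m x. inv (comp1 i) (mul10 E (comp1 i m) (\<sigma>0 x))),
      lact10 = (\<lambda>a u. inv (comp1 i) (mul10 E (\<sigma>1 a) (comp0 i u))),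
      ract01 = (\<lambda>u a. inv (comp1 i) (mul01 E (comp0 i u) (\<sigma>1 a))),
      brL = (\<lambda>x y u. inv (comp1 i) (l3 E (\<sigma>0 x) (\<sigma>0 y) (comp0 i u))),
      brM = (\<lambda>x u y. inv (comp1 i) (l3 E (\<sigma>0 x) (comp0 i u) (\<sigma>0 y))),
      brR = (\<lambda>u x y. inv (comp1 i) (l3 E (comp0 i u) (\<sigma>0 x) (\<sigma>0 y))) \<rparr>"

text \<open>
  The source prints only \<open>comp2 F (comp0 i u) \<alpha> = 0\<close>.  As \<open>comp2 F\<close> is neither symmetric nor
  antisymmetric, the condition is imposed in both arguments; with one argument only,
  equivalent extensions can have different \<open>[x, y, u]\<close>.
\<close>

definition equivalent_extensions ::
  "('k::field, 'e0::ab_group_add, 'e1::ab_group_add) assoc2 \<Rightarrow>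
   ('v0, 'v1, 'e0, 'e1) hom2 \<Rightarrow> ('e0, 'e1, 'a0, 'a1::ab_group_add) hom2 \<Rightarrow>
   ('k, 'f0::ab_group_add, 'f1::ab_group_add) assoc2 \<Rightarrow>
   ('v0, 'v1, 'f0, 'f1) hom2 \<Rightarrow> ('f0, 'f1, 'a0, 'a1) hom2 \<Rightarrow> bool"
  where "equivalent_extensions E i p E' j q \<longleftrightarrow>
    (\<exists>F. assoc_2_hom E E' F \<and> hom2_comp F i = j \<and> hom2_comp q F = p \<and>
         (\<forall>u \<alpha>. comp2 F (comp0 i u) \<alpha> = 0 \<and> comp2 F \<alpha> (comp0 i u) = 0))"

end

theory Submission
  imports Defs
begin

text \<open>
  The actions and brackets attached to a splitting do not use the splitting as such.  If two
  elements of the middle term \<open>E\<close> have the same image under \<open>p\<close>, they differ by an element of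
  the abelian ideal \<open>V\<close>, so they multiply elements of \<open>V\<close> in the same way, and \<open>l\<^sub>3\<close> with one
  argument in \<open>V\<close> does not see the difference either.  Hence \<open>x \<triangleright> u\<close> equals \<open>s \<cdot> u\<close> for
  \<^emph>\<open>every\<close> lift \<open>s\<close> of \<open>x\<close>, and likewise for the other structure maps; the locale
  \<open>lift_action\<close> records this property of a family of maps, and \<open>lift_action_induced_rep\<close> proves it
  for \<open>induced_rep\<close>.

  All three claims follow from it.  First, \<open>s \<cdot> t\<close> lifts \<open>p s \<cdot> p t\<close>, \<open>d s\<close> lifts \<open>d (p s)\<close>,
  and so on, so the identities of a representation, evaluated on lifts, are instances of the
  identities of \<open>E\<close> (\<open>lift_action.assoc_2_rep\<close>).  Secondly, \<open>i\<close> is injective and \<open>p\<close> surjective, so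
  the property determines the maps (\<open>lift_action_unique\<close>) and the splitting is irrelevant.
  Thirdly, an equivalence \<open>F\<close> from \<open>E\<close> to \<open>E'\<close> carries lifts to lifts and is the identity on \<open>V\<close>,
  and every correction term involving \<open>F\<^sub>2\<close> vanishes as soon as one of the arguments of the
  operation lies in \<open>V\<close>; so maps with the property
  for \<open>E'\<close> have it for \<open>E\<close> too (\<open>lift_action_equivalent\<close>).
\<close>

section \<open>Linear and multilinear maps\<close>

lemma linear_map_zero: "Vector_Spaces.linear s1 s2 f \<Longrightarrow> f 0 = 0"
  by (metis module_hom.zero Vector_Spaces.linear_def)

lemma linear_map_diff: "Vector_Spaces.linear s1 s2 f \<Longrightarrow> f (x - y) = f x - f y"
  by (metis module_hom.diff Vector_Spaces.linear_def)

lemma linear_map_add: "Vector_Spaces.linear s1 s2 f \<Longrightarrow> f (x + y) = f x + f y"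
  by (metis module_hom.add Vector_Spaces.linear_def)

lemma linear_map_ident:
  "Vector_Spaces.linear s1 s2 f \<Longrightarrow> Vector_Spaces.linear s1 s1 (\<lambda>x. x)"
  by (simp add: Vector_Spaces.linear_iff)

lemma linear_map_compose:
  "Vector_Spaces.linear s1 s2 f \<Longrightarrow> Vector_Spaces.linear s2 s3 g \<Longrightarrow>
   Vector_Spaces.linear s1 s3 (\<lambda>x. g (f x))"
  by (simp add: Vector_Spaces.linear_iff)

text \<open>
  A map \<open>f\<close> of which only the composite \<open>j \<circ> f \<circ> p\<close> with an injective \<open>j\<close> and a surjective \<open>p\<close> is
  known inherits linearity from that composite.  Applied below with \<open>j\<close> the inclusion of the
  kernel of an extension, and \<open>p\<close> its projection or an identity.
\<close>

lemma linear_of_conjugate: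
  assumes j: "Vector_Spaces.linear s2 s3 j" "inj j"
    and p: "Vector_Spaces.linear s0 s1 p" "surj p"
    and g: "Vector_Spaces.linear s0 s3 g"
    and eq: "\<And>s. j (f (p s)) = g s"
  shows "Vector_Spaces.linear s1 s2 f"
proof -
  have add: "f (x + y) = f x + f y" for x y
  proof -
    obtain s t where st: "x = p s" "y = p t" using p(2) by (metis surjD)
    have "j (f (p (s + t))) = j (f (p s) + f (p t))"
      using j(1) g by (simp add: eq linear_map_add)
    then show ?thesis using j(2) p(1) st by (simp add: inj_eq linear_map_add)
  qed
  have scale: "f (s1 c x) = s2 c (f x)" for c x
  proof -
    obtain s where s: "x = p s" using p(2) by (metis surjD)
    have "j (f (p (s0 c s))) = j (s2 c (f (p s)))"
      using j(1) g by (simp add: eq Vector_Spaces.linear_iff)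
    then show ?thesis using j(2) p(1) s by (simp add: inj_eq Vector_Spaces.linear_iff)
  qed
  show ?thesis
    using j(1) p(1) add scale by (simp add: Vector_Spaces.linear_iff)
qed

lemma bilinear_map_zero:
  assumes "bilinear_map s1 s2 s3 f"
  shows "f 0 y = 0" "f x 0 = 0"
  using assms linear_map_zero[of s1 s3 "\<lambda>x. f x y"] linear_map_zero[of s2 s3 "f x"]
  by (auto simp: bilinear_map_def)

lemma bilinear_map_diff:
  assumes "bilinear_map s1 s2 s3 f"
  shows "f (x - x') y = f x y - f x' y" "f x (y - y') = f x y - f x y'"
  using assms linear_map_diff[of s1 s3 "\<lambda>x. f x y"] linear_map_diff[of s2 s3 "f x"]
  by (auto simp: bilinear_map_def)

lemma trilinear_map_zero:
  assumes "trilinear_map s1 s2 s3 s4 f"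
  shows "f 0 y z = 0" "f x 0 z = 0" "f x y 0 = 0"
  using assms linear_map_zero[of s1 s4 "\<lambda>x. f x y z"] linear_map_zero[of s2 s4 "\<lambda>y. f x y z"]
    linear_map_zero[of s3 s4 "f x y"]
  by (auto simp: trilinear_map_def)

lemma trilinear_map_diff:
  assumes "trilinear_map s1 s2 s3 s4 f"
  shows "f (x - x') y z = f x y z - f x' y z" "f x (y - y') z = f x y z - f x y' z"
    "f x y (z - z') = f x y z - f x y z'"
  using assms linear_map_diff[of s1 s4 "\<lambda>x. f x y z"] linear_map_diff[of s2 s4 "\<lambda>y. f x y z"]
    linear_map_diff[of s3 s4 "f x y"]
  by (auto simp: trilinear_map_def)

lemma bilinear_map_of_conjugate:
  assumes j: "Vector_Spaces.linear s3 t3 j" "inj j"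
    and p1: "Vector_Spaces.linear t1 s1 p1" "surj p1"
    and p2: "Vector_Spaces.linear t2 s2 p2" "surj p2"
    and h1: "Vector_Spaces.linear t1 r1 h1" and h2: "Vector_Spaces.linear t2 r2 h2"
    and g: "bilinear_map r1 r2 t3 g"
    and eq: "\<And>s t. j (f (p1 s) (p2 t)) = g (h1 s) (h2 t)"
  shows "bilinear_map s1 s2 s3 f"
  unfolding bilinear_map_def
proof (intro conjI allI)
  fix x
  obtain s where s: "x = p1 s" using p1(2) by (metis surjD)
  have "Vector_Spaces.linear t2 t3 (\<lambda>t. g (h1 s) (h2 t))"
    using linear_map_compose[OF h2] g by (auto simp: bilinear_map_def)
  then show "Vector_Spaces.linear s2 s3 (f x)"
    using eq s by (intro linear_of_conjugate[OF j p2]) auto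
next
  fix y
  obtain t where t: "y = p2 t" using p2(2) by (metis surjD)
  have "Vector_Spaces.linear t1 t3 (\<lambda>s. g (h1 s) (h2 t))"
    using linear_map_compose[OF h1, where g = "\<lambda>s. g s (h2 t)"] g by (auto simp: bilinear_map_def)
  then show "Vector_Spaces.linear s1 s3 (\<lambda>x. f x y)"
    using eq t by (intro linear_of_conjugate[OF j p1]) auto
qed

lemma trilinear_map_of_conjugate:
  assumes j: "Vector_Spaces.linear s4 t4 j" "inj j"
    and p1: "Vector_Spaces.linear t1 s1 p1" "surj p1"
    and p2: "Vector_Spaces.linear t2 s2 p2" "surj p2"
    and p3: "Vector_Spaces.linear t3 s3 p3" "surj p3"
    and h1: "Vector_Spaces.linear t1 r1 h1" and h2: "Vector_Spaces.linear t2 r2 h2"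
    and h3: "Vector_Spaces.linear t3 r3 h3"
    and g: "trilinear_map r1 r2 r3 t4 g"
    and eq: "\<And>s t r. j (f (p1 s) (p2 t) (p3 r)) = g (h1 s) (h2 t) (h3 r)"
  shows "trilinear_map s1 s2 s3 s4 f"
  unfolding trilinear_map_def
proof (intro conjI allI)
  fix x y
  obtain s t where st: "x = p1 s" "y = p2 t" using p1(2) p2(2) by (metis surjD)
  have "Vector_Spaces.linear t3 t4 (\<lambda>r. g (h1 s) (h2 t) (h3 r))"
    using linear_map_compose[OF h3] g by (auto simp: trilinear_map_def)
  then show "Vector_Spaces.linear s3 s4 (f x y)"
    using eq st by (intro linear_of_conjugate[OF j p3]) auto
next
  fix x z
  obtain s r where st: "x = p1 s" "z = p3 r" using p1(2) p3(2) by (metis surjD)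
  have "Vector_Spaces.linear t2 t4 (\<lambda>t. g (h1 s) (h2 t) (h3 r))"
    using linear_map_compose[OF h2, where g = "\<lambda>t. g (h1 s) t (h3 r)"] g
    by (auto simp: trilinear_map_def)
  then show "Vector_Spaces.linear s2 s4 (\<lambda>y. f x y z)"
    using eq st by (intro linear_of_conjugate[OF j p2]) auto
next
  fix y z
  obtain t r where st: "y = p2 t" "z = p3 r" using p2(2) p3(2) by (metis surjD)
  have "Vector_Spaces.linear t1 t4 (\<lambda>s. g (h1 s) (h2 t) (h3 r))"
    using linear_map_compose[OF h1, where g = "\<lambda>s. g s (h2 t) (h3 r)"] g
    by (auto simp: trilinear_map_def)
  then show "Vector_Spaces.linear s1 s4 (\<lambda>x. f x y z)"
    using eq st by (intro linear_of_conjugate[OF j p1]) auto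
qed


section \<open>Abelian extensions and independence of lifts\<close>

locale abelian_ext =
  fixes V :: "('k::field, 'v0::ab_group_add, 'v1::ab_group_add) assoc2"
    and E :: "('k, 'e0::ab_group_add, 'e1::ab_group_add) assoc2"
    and A :: "('k, 'a0::ab_group_add, 'a1::ab_group_add) assoc2"
    and i :: "('v0, 'v1, 'e0, 'e1) hom2"
    and p :: "('e0, 'e1, 'a0, 'a1) hom2"
  assumes abelian_extension: "abelian_extension V E A i p"
begin

lemma hom_i: "assoc_2_hom V E i" and hom_p: "assoc_2_hom E A p"
  using abelian_extension by (auto simp: abelian_extension_def extension_def strict_hom_def)

sublocale V: assoc_2_algebra V using hom_i by (rule assoc_2_hom.axioms)
sublocale E: assoc_2_algebra E using hom_p by (rule assoc_2_hom.axioms)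
sublocale A: assoc_2_algebra A using hom_p by (rule assoc_2_hom.axioms)
sublocale i: assoc_2_hom V E i by (rule hom_i)
sublocale p: assoc_2_hom E A p by (rule hom_p)

lemma comp2_i [simp]: "comp2 i x y = 0" and comp2_p [simp]: "comp2 p \<alpha> \<beta> = 0"
  using abelian_extension by (auto simp: abelian_extension_def extension_def strict_hom_def)

lemma mul_V [simp]: "mul00 V u v = 0" "mul01 V u m = 0" "mul10 V m u = 0"
  using abelian_extension by (auto simp: abelian_extension_def)

lemma l3_V_V [simp]:
  "l3 E (comp0 i u) (comp0 i v) \<alpha> = 0" "l3 E (comp0 i u) \<alpha> (comp0 i v) = 0"
  "l3 E \<alpha> (comp0 i u) (comp0 i v) = 0"
  using abelian_extension by (auto simp: abelian_extension_def)

lemma exact0: "comp0 p e = 0 \<longleftrightarrow> (\<exists>u. e = comp0 i u)"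
  using abelian_extension by (force simp: abelian_extension_def extension_def set_eq_iff image_iff)

lemma exact1: "comp1 p e = 0 \<longleftrightarrow> (\<exists>m. e = comp1 i m)"
  using abelian_extension by (force simp: abelian_extension_def extension_def set_eq_iff image_iff)

lemma p_i [simp]: "comp0 p (comp0 i u) = 0" "comp1 p (comp1 i m) = 0"
  using exact0 exact1 by blast+

lemma surj_p: "surj (comp0 p)" "surj (comp1 p)"
  using abelian_extension by (auto simp: abelian_extension_def extension_def)

lemma inj_i: "inj (comp0 i)" "inj (comp1 i)"
proof -
  have ker: "comp0 i u = 0 \<Longrightarrow> u = 0" "comp1 i m = 0 \<Longrightarrow> m = 0" for u m
    using abelian_extension by (auto simp: abelian_extension_def extension_def)
  show "inj (comp0 i)"
  proof (rule injI)
    show "x = y" if "comp0 i x = comp0 i y" for x y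
      using ker(1)[of "x - y"] that by (simp add: linear_map_diff[OF i.linear0])
  qed
  show "inj (comp1 i)"
  proof (rule injI)
    show "x = y" if "comp1 i x = comp1 i y" for x y
      using ker(2)[of "x - y"] that by (simp add: linear_map_diff[OF i.linear1])
  qed
qed

lemmas i_eq_iff = inj_eq[OF inj_i(1)] inj_eq[OF inj_i(2)]

lemmas i_linear = linear_map_add[OF i.linear0] linear_map_add[OF i.linear1]
  linear_map_diff[OF i.linear0] linear_map_diff[OF i.linear1]

text \<open>
  Since \<open>p\<close> is strict it commutes with all structure maps.  The equations are oriented so
  that operations of \<open>A\<close> on images are collected into one image of a lift.
\<close>

lemma p_hom:
  "mul00 A (comp0 p s) (comp0 p t) = comp0 p (mul00 E s t)"
  "mul01 A (comp0 p s) (comp1 p a) = comp1 p (mul01 E s a)"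
  "mul10 A (comp1 p a) (comp0 p s) = comp1 p (mul10 E a s)"
  "l3 A (comp0 p s) (comp0 p t) (comp0 p r) = comp1 p (l3 E s t r)"
  "diff A (comp1 p a) = comp0 p (diff E a)"
  using p.comp_mul00[of s t] p.comp_mul01[of s a] p.comp_mul10[of a s] p.comp_l3[of s t r]
    p.comp_diff[of a]
    linear_map_zero[OF A.complex[unfolded two_term_complex_def]]
    bilinear_map_zero[OF A.bilinear_mul01] bilinear_map_zero[OF A.bilinear_mul10]
  by simp_all

text \<open>As \<open>i\<close> is strict, the zero products of \<open>V\<close> are also zero when formed in \<open>E\<close>.\<close>

lemma mul_V_V [simp]:
  "mul00 E (comp0 i u) (comp0 i v) = 0"
  "mul01 E (comp0 i u) (comp1 i m) = 0"
  "mul10 E (comp1 i m) (comp0 i u) = 0"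
  using i.comp_mul00[of u v] i.comp_mul01[of u m] i.comp_mul10[of m u]
    linear_map_zero[OF E.complex[unfolded two_term_complex_def]]
    linear_map_zero[OF i.linear0] linear_map_zero[OF i.linear1]
  by simp_all

text \<open>\<open>V\<close> is an ideal of \<open>E\<close>.\<close>

lemma ideal:
  "\<exists>v. mul00 E s (comp0 i u) = comp0 i v" "\<exists>v. mul00 E (comp0 i u) s = comp0 i v"
  "\<exists>n. mul01 E s (comp1 i m) = comp1 i n" "\<exists>n. mul10 E (comp1 i m) s = comp1 i n"
  "\<exists>n. mul10 E a (comp0 i u) = comp1 i n" "\<exists>n. mul01 E (comp0 i u) a = comp1 i n"
  "\<exists>n. l3 E s t (comp0 i u) = comp1 i n" "\<exists>n. l3 E s (comp0 i u) t = comp1 i n"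
  "\<exists>n. l3 E (comp0 i u) s t = comp1 i n"
  by (simp_all flip: exact0 exact1 p_hom
      add: bilinear_map_zero[OF A.bilinear_mul00] bilinear_map_zero[OF A.bilinear_mul01]
        bilinear_map_zero[OF A.bilinear_mul10] trilinear_map_zero[OF A.trilinear_l3])

text \<open>By exactness, two lifts of one element of \<open>A\<close> differ by an element of \<open>V\<close>.\<close>

lemma lift_difference:
  "comp0 p s = comp0 p s' \<Longrightarrow> \<exists>u. s - s' = comp0 i u"
  "comp1 p a = comp1 p a' \<Longrightarrow> \<exists>m. a - a' = comp1 i m"
  by (simp_all flip: exact0 exact1 add: linear_map_diff[OF p.linear0] linear_map_diff[OF p.linear1])

text \<open>
  The difference of two lifts lies in \<open>V\<close>, and there the products with \<open>V\<close> vanish, as does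
  \<open>l\<^sub>3\<close> with another argument in \<open>V\<close>.  For \<open>l\<^sub>3\<close> this is where its vanishing on two arguments from
  \<open>V\<close>, with the third in \<open>E\<close> arbitrary, is needed.
\<close>

lemma lift_indep0:
  assumes "comp0 p s = comp0 p s'"
  shows "mul00 E s (comp0 i u) = mul00 E s' (comp0 i u)"
    and "mul01 E s (comp1 i m) = mul01 E s' (comp1 i m)"
    and "mul00 E (comp0 i u) s = mul00 E (comp0 i u) s'"
    and "mul10 E (comp1 i m) s = mul10 E (comp1 i m) s'"
    and "l3 E s t (comp0 i u) = l3 E s' t (comp0 i u)"
    and "l3 E t s (comp0 i u) = l3 E t s' (comp0 i u)"
    and "l3 E s (comp0 i u) t = l3 E s' (comp0 i u) t"
    and "l3 E t (comp0 i u) s = l3 E t (comp0 i u) s'"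
    and "l3 E (comp0 i u) s t = l3 E (comp0 i u) s' t"
    and "l3 E (comp0 i u) t s = l3 E (comp0 i u) t s'"
proof -
  obtain v where v: "s - s' = comp0 i v" using lift_difference(1)[OF assms] by blast
  show "mul00 E s (comp0 i u) = mul00 E s' (comp0 i u)"
    and "mul01 E s (comp1 i m) = mul01 E s' (comp1 i m)"
    and "mul00 E (comp0 i u) s = mul00 E (comp0 i u) s'"
    and "mul10 E (comp1 i m) s = mul10 E (comp1 i m) s'"
    and "l3 E s t (comp0 i u) = l3 E s' t (comp0 i u)"
    and "l3 E t s (comp0 i u) = l3 E t s' (comp0 i u)"
    and "l3 E s (comp0 i u) t = l3 E s' (comp0 i u) t"
    and "l3 E t (comp0 i u) s = l3 E t (comp0 i u) s'"
    and "l3 E (comp0 i u) s t = l3 E (comp0 i u) s' t"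
    and "l3 E (comp0 i u) t s = l3 E (comp0 i u) t s'"
    by (subst eq_iff_diff_eq_0, simp flip: bilinear_map_diff[OF E.bilinear_mul00]
        bilinear_map_diff[OF E.bilinear_mul01] bilinear_map_diff[OF E.bilinear_mul10]
        trilinear_map_diff[OF E.trilinear_l3] add: v)+
qed

lemma lift_indep1:
  assumes "comp1 p a = comp1 p a'"
  shows "mul10 E a (comp0 i u) = mul10 E a' (comp0 i u)"
    and "mul01 E (comp0 i u) a = mul01 E (comp0 i u) a'"
proof -
  obtain m where m: "a - a' = comp1 i m" using lift_difference(2)[OF assms] by blast
  show "mul10 E a (comp0 i u) = mul10 E a' (comp0 i u)"
    and "mul01 E (comp0 i u) a = mul01 E (comp0 i u) a'"
    by (subst eq_iff_diff_eq_0, simp flip: bilinear_map_diff[OF E.bilinear_mul01]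
        bilinear_map_diff[OF E.bilinear_mul10] add: m)+
qed

end


section \<open>Actions computed by arbitrary lifts\<close>

text \<open>
  A family \<open>R\<close> of structure maps on \<open>V\<close> is given by lifts if each of its maps, applied to the
  images under \<open>p\<close> of elements of \<open>E\<close>, is the corresponding operation of \<open>E\<close> on these elements.
  Quantifying over all elements of \<open>E\<close> expresses that every choice of lifts gives the same value.
\<close>

locale lift_action = abelian_ext V E A i p
  for V :: "('k::field, 'v0::ab_group_add, 'v1::ab_group_add) assoc2"
    and E :: "('k, 'e0::ab_group_add, 'e1::ab_group_add) assoc2"
    and A :: "('k, 'a0::ab_group_add, 'a1::ab_group_add) assoc2"
    and i :: "('v0, 'v1, 'e0, 'e1) hom2"
    and p :: "('e0, 'e1, 'a0, 'a1) hom2" +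
  fixes R :: "('a0, 'a1, 'v0, 'v1) rep2"
  assumes lact00: "comp0 i (lact00 R (comp0 p s) u) = mul00 E s (comp0 i u)"
    and lact01: "comp1 i (lact01 R (comp0 p s) m) = mul01 E s (comp1 i m)"
    and ract00: "comp0 i (ract00 R u (comp0 p s)) = mul00 E (comp0 i u) s"
    and ract10: "comp1 i (ract10 R m (comp0 p s)) = mul10 E (comp1 i m) s"
    and lact10: "comp1 i (lact10 R (comp1 p a) u) = mul10 E a (comp0 i u)"
    and ract01: "comp1 i (ract01 R u (comp1 p a)) = mul01 E (comp0 i u) a"
    and brL: "comp1 i (brL R (comp0 p s) (comp0 p t) u) = l3 E s t (comp0 i u)"
    and brM: "comp1 i (brM R (comp0 p s) u (comp0 p t)) = l3 E s (comp0 i u) t"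
    and brR: "comp1 i (brR R u (comp0 p s) (comp0 p t)) = l3 E (comp0 i u) s t"
begin

lemmas lifts = lact00 lact01 ract00 ract10 lact10 ract01 brL brM brR

theorem assoc_2_rep: "assoc_2_rep A V R"
proof -
  note id0 = linear_map_ident[OF i.linear0] surj_id[unfolded id_def]
  note id1 = linear_map_ident[OF i.linear1] surj_id[unfolded id_def]
  note idE0 = linear_map_ident[OF p.linear0]
  note idE1 = linear_map_ident[OF p.linear1]
  note p0 = p.linear0 surj_p(1)
  note p1 = p.linear1 surj_p(2)
  note i0 = i.linear0 inj_i(1)
  note i1 = i.linear1 inj_i(2)
  \<comment> \<open>Moves an identity in \<open>V\<close>, with elements of \<open>A\<close> written as images of lifts, into \<open>E\<close>.\<close>
  note to_E = i_eq_iff[symmetric] i_linear p_hom lifts i.comp_diff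
  show ?thesis
  proof unfold_locales
    show "two_term_complex V" by (rule V.complex)
    show "bilinear_map (scale0 A) (scale0 V) (scale0 V) (lact00 R)"
      by (rule bilinear_map_of_conjugate[OF i0 p0 id0 idE0 i0(1) E.bilinear_mul00])
        (rule lact00)
    show "bilinear_map (scale0 A) (scale1 V) (scale1 V) (lact01 R)"
      by (rule bilinear_map_of_conjugate[OF i1 p0 id1 idE0 i1(1) E.bilinear_mul01])
        (rule lact01)
    show "bilinear_map (scale0 V) (scale0 A) (scale0 V) (ract00 R)"
      by (rule bilinear_map_of_conjugate[OF i0 id0 p0 i0(1) idE0 E.bilinear_mul00])
        (rule ract00)
    show "bilinear_map (scale1 V) (scale0 A) (scale1 V) (ract10 R)"
      by (rule bilinear_map_of_conjugate[OF i1 id1 p0 i1(1) idE0 E.bilinear_mul10])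
        (rule ract10)
    show "bilinear_map (scale1 A) (scale0 V) (scale1 V) (lact10 R)"
      by (rule bilinear_map_of_conjugate[OF i1 p1 id0 idE1 i0(1) E.bilinear_mul10])
        (rule lact10)
    show "bilinear_map (scale0 V) (scale1 A) (scale1 V) (ract01 R)"
      by (rule bilinear_map_of_conjugate[OF i1 id0 p1 i0(1) idE1 E.bilinear_mul01])
        (rule ract01)
    show "trilinear_map (scale0 A) (scale0 A) (scale0 V) (scale1 V) (brL R)"
      by (rule trilinear_map_of_conjugate[OF i1 p0 p0 id0 idE0 idE0 i0(1) E.trilinear_l3])
        (rule brL)
    show "trilinear_map (scale0 A) (scale0 V) (scale0 A) (scale1 V) (brM R)"
      by (rule trilinear_map_of_conjugate[OF i1 p0 id0 p0 idE0 i0(1) idE0 E.trilinear_l3])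
        (rule brM)
    show "trilinear_map (scale0 V) (scale0 A) (scale0 A) (scale1 V) (brR R)"
      by (rule trilinear_map_of_conjugate[OF i1 id0 p0 p0 i0(1) idE0 idE0 E.trilinear_l3])
        (rule brR)
  next
    \<comment> \<open>On lifts each identity is an axiom of \<open>E\<close> with one of its arguments in \<open>V\<close>.\<close>
    fix x y z :: 'a0 and a :: 'a1 and u :: 'v0 and m :: 'v1
    obtain s t r b where [simp]: "x = comp0 p s" "y = comp0 p t" "z = comp0 p r" "a = comp1 p b"
      using surj_p by (metis surjD)
    show "lact00 R (mul00 A x y) u - lact00 R x (lact00 R y u) = diff V (brL R x y u)"
      by (simp add: to_E E.diff_l3)
    show "lact01 R (mul00 A x y) m - lact01 R x (lact01 R y m) = brL R x y (diff V m)"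
      by (simp add: to_E E.l3_diff3)
    show "lact10 R (mul01 A x a) u - lact01 R x (lact10 R a u) = brL R x (diff A a) u"
      by (simp add: to_E E.l3_diff2)
    show "lact10 R (mul10 A a x) u - lact10 R a (lact00 R x u) = brL R (diff A a) x u"
      by (simp add: to_E E.l3_diff1)
    show "ract00 R (lact00 R x u) y - lact00 R x (ract00 R u y) = diff V (brM R x u y)"
      by (simp add: to_E E.diff_l3)
    show "ract10 R (lact01 R x m) y - lact01 R x (ract10 R m y) = brM R x (diff V m) y"
      by (simp add: to_E E.l3_diff2)
    show "ract01 R (lact00 R x u) a - lact01 R x (ract01 R u a) = brM R x u (diff A a)"
      by (simp add: to_E E.l3_diff3)
    show "ract10 R (lact10 R a u) y - lact10 R a (ract00 R u y) = brM R (diff A a) u y"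
      by (simp add: to_E E.l3_diff1)
    show "ract00 R (ract00 R u x) y - ract00 R u (mul00 A x y) = diff V (brR R u x y)"
      by (simp add: to_E E.diff_l3)
    show "ract10 R (ract10 R m x) y - ract10 R m (mul00 A x y) = brR R (diff V m) x y"
      by (simp add: to_E E.l3_diff1)
    show "ract01 R (ract00 R u x) a - ract01 R u (mul01 A x a) = brR R u x (diff A a)"
      by (simp add: to_E E.l3_diff3)
    show "ract10 R (ract01 R u a) x - ract01 R u (mul10 A a x) = brR R u (diff A a) x"
      by (simp add: to_E E.l3_diff2)
    show "lact01 R x (brR R u y z) + ract10 R (brM R x u y) z =
          brR R (lact00 R x u) y z - brM R x (ract00 R u y) z + brM R x u (mul00 A y z)"
      by (simp add: to_E E.l3_cocycle)
    show "lact01 R x (brM R y u z) + ract10 R (brL R x y u) z =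
          brM R (mul00 A x y) u z - brM R x (lact00 R y u) z + brL R x y (ract00 R u z)"
      by (simp add: to_E E.l3_cocycle)
    show "lact01 R x (brL R y z u) + lact10 R (l3 A x y z) u =
          brL R (mul00 A x y) z u - brL R x (mul00 A y z) u + brL R x y (lact00 R z u)"
      by (simp add: to_E E.l3_cocycle)
    show "ract01 R u (l3 A x y z) + ract10 R (brR R u x y) z =
          brR R (ract00 R u x) y z - brR R u (mul00 A x y) z + brR R u x (mul00 A y z)"
      by (simp add: to_E E.l3_cocycle)
  qed
qed

end

theorem lift_action_unique:
  assumes "lift_action V E A i p R" and "lift_action V E A i p R'"
  shows "R = R'"
proof -
  interpret R: lift_action V E A i p R by fact
  interpret R': lift_action V E A i p R' by fact
  have lift: "\<exists>s. x = comp0 p s" "\<exists>b. a = comp1 p b" for x a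
    using R.surj_p by (metis surjD)+
  show ?thesis
  proof (rule rep2.equality)
    show "lact00 R = lact00 R'"
      using lift by (metis ext R.i_eq_iff(1) R.lact00 R'.lact00)
    show "lact01 R = lact01 R'"
      using lift by (metis ext R.i_eq_iff(2) R.lact01 R'.lact01)
    show "ract00 R = ract00 R'"
      using lift by (metis ext R.i_eq_iff(1) R.ract00 R'.ract00)
    show "ract10 R = ract10 R'"
      using lift by (metis ext R.i_eq_iff(2) R.ract10 R'.ract10)
    show "lact10 R = lact10 R'"
      using lift by (metis ext R.i_eq_iff(2) R.lact10 R'.lact10)
    show "ract01 R = ract01 R'"
      using lift by (metis ext R.i_eq_iff(2) R.ract01 R'.ract01)
    show "brL R = brL R'"
      using lift by (metis ext R.i_eq_iff(2) R.brL R'.brL)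
    show "brM R = brM R'"
      using lift by (metis ext R.i_eq_iff(2) R.brM R'.brM)
    show "brR R = brR R'"
      using lift by (metis ext R.i_eq_iff(2) R.brR R'.brR)
  qed simp
qed

theorem lift_action_induced_rep:
  assumes "abelian_extension V E A i p" and "splitting E A p \<sigma>0 \<sigma>1"
  shows "lift_action V E A i p (induced_rep E i \<sigma>0 \<sigma>1)"
proof -
  interpret abelian_ext V E A i p by standard fact
  have \<sigma>: "comp0 p (\<sigma>0 x) = x" "comp1 p (\<sigma>1 a) = a" for x a
    using assms(2) by (auto simp: splitting_def fun_eq_iff)
  have i_inv: "\<exists>v. e = comp0 i v \<Longrightarrow> comp0 i (inv (comp0 i) e) = e"
    "\<exists>n. f = comp1 i n \<Longrightarrow> comp1 i (inv (comp1 i) f) = f" for e f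
    using inj_i by (auto simp: inv_f_f)
  show ?thesis
    \<comment> \<open>The canonical lift \<open>\<sigma> (p s)\<close> may be replaced by \<open>s\<close>.\<close>
    by unfold_locales
      (simp_all add: induced_rep_def i_inv ideal,
        simp_all add: \<sigma>
          lift_indep0[of "\<sigma>0 (comp0 p s)" s for s]
          lift_indep1[of "\<sigma>1 (comp1 p a)" a for a])
qed


section \<open>Equivalent extensions\<close>

text \<open>
  The condition \<open>q \<circ> F = p\<close> in degree 2 says that \<open>F\<^sub>2\<close> takes values in \<open>V\<close>; this disposes of
  the two correction terms, \<open>F\<^sub>2(s, t) \<cdot> u\<close> and \<open>u \<cdot> F\<^sub>2(s, t)\<close> with \<open>u\<close> in \<open>V\<close>, in which no
  argument of \<open>F\<^sub>2\<close> need lie in \<open>V\<close>.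
\<close>

theorem lift_action_equivalent:
  fixes V :: "('k::field, 'v0::ab_group_add, 'v1::ab_group_add) assoc2"
    and E :: "('k, 'e0::ab_group_add, 'e1::ab_group_add) assoc2"
  assumes "abelian_extension V E A i p" and "equivalent_extensions E i p E' j q"
    and "lift_action V E' A j q R"
  shows "lift_action V E A i p R"
proof -
  interpret E: abelian_ext V E A i p by standard fact
  interpret E': lift_action V E' A j q R by fact
  obtain F where "assoc_2_hom E E' F"
    and F_i: "hom2_comp F i = j" and q_F: "hom2_comp q F = p"
    and F2: "\<And>u \<alpha>. comp2 F (comp0 i u) \<alpha> = 0" "\<And>u \<alpha>. comp2 F \<alpha> (comp0 i u) = 0"
    using assms(2) by (auto simp: equivalent_extensions_def)
  then interpret F: assoc_2_hom E E' F by simp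
  have j: "comp0 F (comp0 i u) = comp0 j u" "comp1 F (comp1 i m) = comp1 j m" for u m
    using F_i by (auto simp: hom2_comp_def)
  have p: "comp0 p s = comp0 q (comp0 F s)" "comp1 p a = comp1 q (comp1 F a)" for s a
    using q_F by (auto simp: hom2_comp_def)
  have "comp2 q (comp0 F s) (comp0 F t) + comp1 q (comp2 F s t) = 0" for s t
    using E.comp2_p[of s t] unfolding q_F[symmetric] by (simp add: hom2_comp_def)
  then have F2_V: "\<exists>m. comp2 F s t = comp1 j m" for s t
    by (simp flip: E'.exact1)
  have F2_V_mul: "mul10 E' (comp2 F s t) (comp0 j u) = 0" "mul01 E' (comp0 j u) (comp2 F s t) = 0"
    for s t u
    using F2_V[of s t] by auto
  have F2_ideal: "comp2 F r (mul00 E s (comp0 i u)) = 0" "comp2 F r (mul00 E (comp0 i u) s) = 0"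
    "comp2 F (mul00 E s (comp0 i u)) r = 0" "comp2 F (mul00 E (comp0 i u) s) r = 0" for r s u
    using E.ideal(1)[of s u] E.ideal(2)[of u s] F2 by auto
  \<comment> \<open>Equality of elements of \<open>V\<close> in \<open>E\<close> may be tested after applying \<open>F\<close>.\<close>
  have reflect: "\<exists>v'. e = comp0 i v' \<Longrightarrow> comp0 F e = comp0 j v \<Longrightarrow> comp0 i v = e"
    "\<exists>n'. f = comp1 i n' \<Longrightarrow> comp1 F f = comp1 j n \<Longrightarrow> comp1 i n = f" for e v f n
    by (auto simp: j E'.i_eq_iff)
  note zero = linear_map_zero[OF E'.E.complex[unfolded two_term_complex_def]]
    bilinear_map_zero[OF E'.E.bilinear_mul01] bilinear_map_zero[OF E'.E.bilinear_mul10]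
  show ?thesis
  proof unfold_locales
    fix s t :: 'e0 and a :: 'e1 and u :: 'v0 and m :: 'v1
    show "comp0 i (lact00 R (comp0 p s) u) = mul00 E s (comp0 i u)"
      using F.comp_mul00[of s "comp0 i u"]
      by (intro reflect E.ideal) (simp add: F2 j p E'.lifts zero)
    show "comp1 i (lact01 R (comp0 p s) m) = mul01 E s (comp1 i m)"
      using F.comp_mul01[of s "comp1 i m"]
      by (intro reflect E.ideal) (simp add: F2 j p E'.lifts flip: E.i.comp_diff)
    show "comp0 i (ract00 R u (comp0 p s)) = mul00 E (comp0 i u) s"
      using F.comp_mul00[of "comp0 i u" s]
      by (intro reflect E.ideal) (simp add: F2 j p E'.lifts zero)
    show "comp1 i (ract10 R m (comp0 p s)) = mul10 E (comp1 i m) s"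
      using F.comp_mul10[of "comp1 i m" s]
      by (intro reflect E.ideal) (simp add: F2 j p E'.lifts flip: E.i.comp_diff)
    show "comp1 i (lact10 R (comp1 p a) u) = mul10 E a (comp0 i u)"
      using F.comp_mul10[of a "comp0 i u"]
      by (intro reflect E.ideal) (simp add: F2 j p E'.lifts)
    show "comp1 i (ract01 R u (comp1 p a)) = mul01 E (comp0 i u) a"
      using F.comp_mul01[of "comp0 i u" a]
      by (intro reflect E.ideal) (simp add: F2 j p E'.lifts)
    show "comp1 i (brL R (comp0 p s) (comp0 p t) u) = l3 E s t (comp0 i u)"
      using F.comp_l3[of s t "comp0 i u"]
      by (intro reflect E.ideal) (simp add: F2 F2_ideal F2_V_mul j p E'.lifts zero)
    show "comp1 i (brM R (comp0 p s) u (comp0 p t)) = l3 E s (comp0 i u) t"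
      using F.comp_l3[of s "comp0 i u" t]
      by (intro reflect E.ideal) (simp add: F2 F2_ideal j p E'.lifts zero)
    show "comp1 i (brR R u (comp0 p s) (comp0 p t)) = l3 E (comp0 i u) s t"
      using F.comp_l3[of "comp0 i u" s t]
      by (intro reflect E.ideal) (simp add: F2 F2_ideal F2_V_mul j p E'.lifts zero)
  qed
qed


section \<open>The representation of an abelian extension\<close>

theorem proposition4p2:
  fixes V :: "('k::field, 'v0::ab_group_add, 'v1::ab_group_add) assoc2"
    and E :: "('k, 'e0::ab_group_add, 'e1::ab_group_add) assoc2"
    and A :: "('k, 'a0::ab_group_add, 'a1::ab_group_add) assoc2"
    and i :: "('v0, 'v1, 'e0, 'e1) hom2"
    and p :: "('e0, 'e1, 'a0, 'a1) hom2"
    and \<sigma>0 :: "'a0 \<Rightarrow> 'e0" and \<sigma>1 :: "'a1 \<Rightarrow> 'e1"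
  assumes "abelian_extension V E A i p"
    and "splitting E A p \<sigma>0 \<sigma>1"
  shows "assoc_2_rep A V (induced_rep E i \<sigma>0 \<sigma>1) \<and>
    (\<forall>\<tau>0 \<tau>1. splitting E A p \<tau>0 \<tau>1 \<longrightarrow> induced_rep E i \<tau>0 \<tau>1 = induced_rep E i \<sigma>0 \<sigma>1) \<and>
    (\<forall>(E' :: ('k, 'f0::ab_group_add, 'f1::ab_group_add) assoc2) j q \<tau>0 \<tau>1.
       abelian_extension V E' A j q \<longrightarrow> equivalent_extensions E i p E' j q \<longrightarrow>
       splitting E' A q \<tau>0 \<tau>1 \<longrightarrow> induced_rep E' j \<tau>0 \<tau>1 = induced_rep E i \<sigma>0 \<sigma>1)"
proof (intro conjI allI impI)
  have R: "lift_action V E A i p (induced_rep E i \<sigma>0 \<sigma>1)"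
    using assms by (rule lift_action_induced_rep)
  show "assoc_2_rep A V (induced_rep E i \<sigma>0 \<sigma>1)"
    using R by (rule lift_action.assoc_2_rep)
  show "induced_rep E i \<tau>0 \<tau>1 = induced_rep E i \<sigma>0 \<sigma>1" if "splitting E A p \<tau>0 \<tau>1" for \<tau>0 \<tau>1
    using lift_action_induced_rep[OF assms(1) that] R by (rule lift_action_unique)
  show "induced_rep E' j \<tau>0 \<tau>1 = induced_rep E i \<sigma>0 \<sigma>1"
    if "abelian_extension V E' A j q" "equivalent_extensions E i p E' j q"
      "splitting E' A q \<tau>0 \<tau>1"
    for E' :: "('k, 'f0, 'f1) assoc2" and j q \<tau>0 \<tau>1
    using lift_action_equivalent[OF assms(1) that(2) lift_action_induced_rep[OF that(1,3)]] R
    by (rule lift_action_unique)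
qed

end
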